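(* Let $D$ be an integral domain with quotient field $K$, and $M$ a maximal ideal of $D$ of finite index such that $\bigcap_{k\ge1}M^k=(0)$ and $D_M$ is analytically irreducible. Let $\hat D$ be the $M$-adic completion of $D$ (an integral domain containing $D$), let $n\ge1$ and $C\in M_n(\hat D)$. Then for every $f\in\mathrm{Int}_K(M_n(D))$ the matrix $f(C)$ lies in $\hat D[C]=\{s(C)\mid s\in\hat D[x]\}$; that is, $\mathrm{Int}_K(M_n(D))(C)\subseteq \hat D[C]$.
   Context: $M_n(R)$ is the ring of $n\times n$ matrices over $R$. $\mathrm{Int}_K(M_n(D))=\{f\in K[x]\mid f(C)\in M_n(D)\text{ for all }C\in M_n(D)\}$. A local domain is analytically irreducible if its completion is a domain. For $f=g/d$ with $g\in D[x]$, $d\in D\setminus\{0\}$, and $C\in M_n(\hat D)$, $f(C)$ is $d^{-1}g(C)$ computed in $M_n(L)$, where $L$ is the quotient field of $\hat D$; $\mathrm{Int}_K(M_n(D))(C)=\{f(C)\mid f\in \mathrm{Int}_K(M_n(D))\}$. *)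

theory Defs
  imports "HOL-Algebra.QuotRing" "HOL-Algebra.Ideal_Product"
    "HOL-Computational_Algebra.Polynomial" "HOL-Computational_Algebra.Fraction_Field"
begin

definition class_ring :: "('b::comm_ring_1) ring" where
  "class_ring = \<lparr>carrier = UNIV, monoid.mult = (*), one = 1, zero = 0, add = (+)\<rparr>"

definition sub_ring :: "('b::comm_ring_1) set \<Rightarrow> 'b ring" where
  "sub_ring S = \<lparr>carrier = S, monoid.mult = (*), one = 1, zero = 0, add = (+)\<rparr>"

primrec ideal_pow :: "('b, 'm) ring_scheme \<Rightarrow> 'b set \<Rightarrow> nat \<Rightarrow> 'b set" where
  "ideal_pow R I 0 = carrier R"
| "ideal_pow R I (Suc k) = ideal_prod R (ideal_pow R I k) I"

(* I-adic completion of R: the inverse limit of R/I^k, i.e. compatible sequences of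
   cosets x k \<in> R/I^k with x (k+1) \<subseteq> x k, with componentwise ring operations. *)
definition adic_completion :: "('b, 'm) ring_scheme \<Rightarrow> 'b set \<Rightarrow> (nat \<Rightarrow> 'b set) ring" where
  "adic_completion R I =
    \<lparr>carrier = {x. \<forall>k. x k \<in> a_rcosets\<^bsub>R\<^esub> (ideal_pow R I k) \<and> x (Suc k) \<subseteq> x k},
     monoid.mult = (\<lambda>x y k. rcoset_mult R (ideal_pow R I k) (x k) (y k)),
     one = (\<lambda>k. ideal_pow R I k +>\<^bsub>R\<^esub> \<one>\<^bsub>R\<^esub>),
     zero = (\<lambda>k. ideal_pow R I k),
     add = (\<lambda>x y k. set_add R (x k) (y k))\<rparr>"

definition adic_emb :: "('b, 'm) ring_scheme \<Rightarrow> 'b set \<Rightarrow> 'b \<Rightarrow> (nat \<Rightarrow> 'b set)" where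
  "adic_emb R I a = (\<lambda>k. ideal_pow R I k +>\<^bsub>R\<^esub> a)"

definition localization :: "('a::idom) set \<Rightarrow> 'a fract set" where
  "localization M = {Fract a s | a s. s \<notin> M}"

definition loc_max_ideal :: "('a::idom) set \<Rightarrow> 'a fract set" where
  "loc_max_ideal M = {Fract a s | a s. a \<in> M \<and> s \<notin> M}"

definition analytically_irreducible :: "('b, 'm) ring_scheme \<Rightarrow> 'b set \<Rightarrow> bool" where
  "analytically_irreducible R m \<longleftrightarrow> domain (adic_completion R m)"

(* n x n matrices over a ring record R, as functions nat \<Rightarrow> nat \<Rightarrow> _ (only entries i,j < n matter). *)
definition mat_mult :: "('c, 'm) ring_scheme \<Rightarrow> nat \<Rightarrow> (nat \<Rightarrow> nat \<Rightarrow> 'c) \<Rightarrow> (nat \<Rightarrow> nat \<Rightarrow> 'c) \<Rightarrow> nat \<Rightarrow> nat \<Rightarrow> 'c" where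
  "mat_mult R n A B = (\<lambda>i j. finsum R (\<lambda>k. A i k \<otimes>\<^bsub>R\<^esub> B k j) {..<n})"

definition mat_one :: "('c, 'm) ring_scheme \<Rightarrow> nat \<Rightarrow> nat \<Rightarrow> 'c" where
  "mat_one R = (\<lambda>i j. if i = j then \<one>\<^bsub>R\<^esub> else \<zero>\<^bsub>R\<^esub>)"

primrec mat_pow :: "('c, 'm) ring_scheme \<Rightarrow> nat \<Rightarrow> (nat \<Rightarrow> nat \<Rightarrow> 'c) \<Rightarrow> nat \<Rightarrow> nat \<Rightarrow> nat \<Rightarrow> 'c" where
  "mat_pow R n A 0 = mat_one R"
| "mat_pow R n A (Suc k) = mat_mult R n (mat_pow R n A k) A"

definition mat_poly_eval :: "('c, 'm) ring_scheme \<Rightarrow> nat \<Rightarrow> 'c list \<Rightarrow> (nat \<Rightarrow> nat \<Rightarrow> 'c) \<Rightarrow> nat \<Rightarrow> nat \<Rightarrow> 'c" where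
  "mat_poly_eval R n cs A = (\<lambda>i j. finsum R (\<lambda>m. (cs ! m) \<otimes>\<^bsub>R\<^esub> mat_pow R n A m i j) {..<length cs})"

definition Int_mat :: "nat \<Rightarrow> ('a::idom) fract poly set" where
  "Int_mat n = {f. \<forall>C :: nat \<Rightarrow> nat \<Rightarrow> 'a. \<forall>i<n. \<forall>j<n.
       mat_poly_eval (class_ring :: 'a fract ring) n (coeffs f) (\<lambda>i j. Fract (C i j) 1) i j
         \<in> range (\<lambda>a. Fract a 1)}"

end

theory Submission
  imports Defs "Jordan_Normal_Form.Char_Poly"
begin

text \<open>Write \<open>f = g / d\<close>, and let \<open>\<chi>\<close> be the characteristic polynomial of a matrix \<open>A\<close> over \<open>D\<close>. By
  Cayley-Hamilton, \<open>g(A) = r(A)\<close> for the remainder \<open>r\<close> of \<open>g\<close> modulo \<open>\<chi>\<close>, and the coefficients of \<open>r\<close>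
  form the first column of \<open>g\<close> evaluated at the companion matrix of \<open>\<chi>\<close>. As \<open>f\<close> is integer-valued,
  \<open>r = d s\<close> with \<open>s\<close> over \<open>D\<close>, so \<open>f(A) = s(A)\<close>.

  Moreover \<open>f\<close> is uniformly continuous on matrices over \<open>D\<close> for the \<open>M\<close>-adic topology: an
  integer-valued polynomial of degree at most \<open>N\<close> that vanishes at \<open>0\<close> maps products of \<open>N k\<close>
  elements of \<open>M\<close> into \<open>M ^ k\<close>. So if matrices over \<open>D\<close> converge to \<open>C\<close>, the associated polynomials
  \<open>s\<close> converge too, and their limit \<open>s\<close> satisfies \<open>g(C) = d s(C)\<close>.\<close>

hide_const (open) Module.smult

section \<open>Matrices over a commutative ring type, written as sums\<close>

lemma class_ring_simps [simp]:
  "carrier class_ring = UNIV" "a \<otimes>\<^bsub>class_ring\<^esub> b = a * b" "\<one>\<^bsub>class_ring\<^esub> = 1"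
  "\<zero>\<^bsub>class_ring\<^esub> = 0" "a \<oplus>\<^bsub>class_ring\<^esub> b = a + b"
  by (simp_all add: class_ring_def)

lemma cring_class_ring: "cring (class_ring :: 'b::comm_ring_1 ring)"
proof (rule cringI)
  show "abelian_group (class_ring :: 'b ring)"
    by (rule abelian_groupI) (auto simp: algebra_simps intro: exI[of _ "- _"])
  show "comm_monoid (class_ring :: 'b ring)"
    by (rule comm_monoidI) (auto simp: algebra_simps)
qed (auto simp: algebra_simps)

lemma finsum_class_ring [simp]:
  assumes "finite A"
  shows "finsum (class_ring :: 'b::comm_ring_1 ring) f A = sum f A"
proof -
  interpret cring "class_ring :: 'b ring" by (rule cring_class_ring)
  show ?thesis using assms by (induction rule: finite_induct) auto
qed

lemma mat_pow_class_ring_Suc: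
  "mat_pow (class_ring :: 'b::comm_ring_1 ring) n A (Suc m) i j
     = (\<Sum>k<n. mat_pow class_ring n A m i k * A k j)"
  by (simp add: mat_mult_def)

text \<open>\<open>mat_pow\<close> grows on the right, while the telescoping for Cayley-Hamilton and
  the companion matrix need a factor split off on the left.\<close>

lemma mat_pow_class_ring_Suc_left:
  assumes "i < n" "j < n"
  shows "mat_pow (class_ring :: 'b::comm_ring_1 ring) n A (Suc m) i j
    = (\<Sum>k<n. A i k * mat_pow class_ring n A m k j)"
  using assms
proof (induction m arbitrary: j)
  case 0
  then show ?case
    by (simp add: mat_mult_def mat_one_def if_distrib[of "\<lambda>x. x * _"] if_distrib[of "\<lambda>x. _ * x"]
        cong: if_cong)
next
  case (Suc m)
  have "mat_pow class_ring n A (Suc (Suc m)) i j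
      = (\<Sum>l<n. (\<Sum>k<n. A i k * mat_pow class_ring n A m k l) * A l j)"
    unfolding mat_pow_class_ring_Suc[of n A "Suc m"] using Suc by (intro sum.cong) auto
  also have "\<dots> = (\<Sum>k<n. A i k * (\<Sum>l<n. mat_pow class_ring n A m k l * A l j))"
    by (simp add: sum_distrib_left sum_distrib_right mult.assoc) (rule sum.swap)
  finally show ?case by (simp only: mat_pow_class_ring_Suc)
qed

lemma mat_poly_eval_class_ring:
  "mat_poly_eval (class_ring :: 'b::comm_ring_1 ring) n cs A i j
     = (\<Sum>m<length cs. cs ! m * mat_pow class_ring n A m i j)"
  by (simp add: mat_poly_eval_def)

subsection \<open>Congruences modulo an ideal\<close>

text \<open>A locale, because the congruence rules are used for several ideals: the powers of
  \<open>I\<close>, the zero ideal and an ideal of polynomials.\<close>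

locale class_ideal =
  fixes I :: "'b::comm_ring_1 set"
  assumes ideal: "ideal I class_ring"
begin

lemma zero: "0 \<in> I"
  using additive_subgroup.zero_closed[OF ideal.axioms(1)[OF ideal]] by simp

lemma add: "a \<in> I \<Longrightarrow> b \<in> I \<Longrightarrow> a + b \<in> I"
  using additive_subgroup.a_closed[OF ideal.axioms(1)[OF ideal], of a b] by simp

lemma mult_left: "a \<in> I \<Longrightarrow> b * a \<in> I"
  using ideal.I_l_closed[OF ideal, of a b] by simp

lemma mult_right: "a \<in> I \<Longrightarrow> a * b \<in> I"
  using mult_left[of a b] by (simp add: mult.commute)

lemma uminus: "a \<in> I \<Longrightarrow> - a \<in> I"
  using mult_left[of a "- 1"] by simp

lemma diff: "a \<in> I \<Longrightarrow> b \<in> I \<Longrightarrow> a - b \<in> I"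
  using add[of a "- b"] uminus[of b] by simp

lemma sum: "(\<And>x. x \<in> S \<Longrightarrow> f x \<in> I) \<Longrightarrow> sum f S \<in> I"
  by (induction S rule: infinite_finite_induct) (auto intro: zero add)

lemma cong_trans: "a - b \<in> I \<Longrightarrow> b - c \<in> I \<Longrightarrow> a - c \<in> I"
  using add[of "a - b" "b - c"] by simp

lemma cong_add: "a - b \<in> I \<Longrightarrow> c - d \<in> I \<Longrightarrow> (a + c) - (b + d) \<in> I"
  using add[of "a - b" "c - d"] by (simp add: algebra_simps)

lemma cong_mult:
  assumes "a - b \<in> I" "c - d \<in> I"
  shows "a * c - b * d \<in> I"
proof -
  have "a * c - b * d = a * (c - d) + (a - b) * d" by (simp add: algebra_simps)
  then show ?thesis using assms by (auto intro: add mult_left mult_right)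
qed

lemma cong_sum: "(\<And>x. x \<in> S \<Longrightarrow> f x - g x \<in> I) \<Longrightarrow> sum f S - sum g S \<in> I"
  using sum[of S "\<lambda>x. f x - g x"] by (simp add: sum_subtractf)

lemma cong_prod: "(\<And>x. x \<in> S \<Longrightarrow> f x - g x \<in> I) \<Longrightarrow> prod f S - prod g S \<in> I"
  by (induction S rule: infinite_finite_induct) (auto simp: zero intro: cong_mult)

lemma cong_mat_pow:
  assumes "\<And>i j. i < n \<Longrightarrow> j < n \<Longrightarrow> A i j - B i j \<in> I" "i < n" "j < n"
  shows "mat_pow class_ring n A m i j - mat_pow class_ring n B m i j \<in> I"
  using assms(2,3)
proof (induction m arbitrary: i j)
  case 0
  then show ?case by (simp add: zero)
next
  case (Suc m)
  show ?case unfolding mat_pow_class_ring_Suc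
    using Suc assms(1) by (intro cong_sum cong_mult) auto
qed

lemma cong_mat_poly_eval:
  assumes "\<And>i j. i < n \<Longrightarrow> j < n \<Longrightarrow> A i j - B i j \<in> I" "i < n" "j < n"
    "length cs = length ds" "\<And>m. m < length cs \<Longrightarrow> cs ! m - ds ! m \<in> I"
  shows "mat_poly_eval class_ring n cs A i j - mat_poly_eval class_ring n ds B i j \<in> I"
  unfolding mat_poly_eval_class_ring assms(4)[symmetric]
  using assms by (intro cong_sum cong_mult cong_mat_pow) auto

text \<open>The characteristic matrix has polynomial entries, so congruences between such
  determinants are taken modulo \<open>I[x]\<close>.\<close>

lemma class_ideal_poly: "class_ideal {p. \<forall>i. coeff p i \<in> I}"
proof (rule class_ideal.intro)
  interpret R: cring "class_ring :: 'b poly ring" by (rule cring_class_ring)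
  have inv: "\<ominus>\<^bsub>class_ring\<^esub> p = - p" for p :: "'b poly"
    using R.minus_equality[of "- p" p] by simp
  show "ideal {p. \<forall>i. coeff p i \<in> I} class_ring"
  proof (rule idealI)
    show "subgroup {p. \<forall>i. coeff p i \<in> I} (add_monoid class_ring)"
    proof (rule group.subgroupI[OF R.a_group])
      fix p assume "p \<in> {p. \<forall>i. coeff p i \<in> I}"
      then show "inv\<^bsub>add_monoid class_ring\<^esub> p \<in> {p. \<forall>i. coeff p i \<in> I}"
        unfolding a_inv_def[symmetric] inv by (simp add: uminus)
    qed (auto simp: zero add intro: exI[of _ 0])
  qed (auto simp: coeff_mult R.ring_axioms intro!: sum intro: mult_left mult_right)
qed

end

subsection \<open>The characteristic polynomial\<close>

definition char_coeff :: "nat \<Rightarrow> (nat \<Rightarrow> nat \<Rightarrow> 'b::comm_ring_1) \<Rightarrow> nat \<Rightarrow> 'b" where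
  "char_coeff n A = coeff (char_poly (mat n n (\<lambda>(i, j). A i j)))"

text \<open>By the Leibniz formula a determinant is a sum of signed products of entries, and these
  respect congruences.\<close>

lemma (in class_ideal) cong_char_coeff:
  assumes "\<And>i j. i < n \<Longrightarrow> j < n \<Longrightarrow> A i j - B i j \<in> I"
  shows "char_coeff n A l - char_coeff n B l \<in> I"
proof -
  interpret P: class_ideal "{p. \<forall>i. coeff p i \<in> I}" by (rule class_ideal_poly)
  let ?M = "\<lambda>A. mat n n (\<lambda>(i, j). A i j)"
  have "char_poly (?M A) - char_poly (?M B) \<in> {p. \<forall>i. coeff p i \<in> I}"
    unfolding char_poly_def det_def'[OF char_poly_matrix_closed[OF mat_carrier]]
  proof (intro P.cong_sum P.cong_mult P.cong_prod)
    fix p i assume "p \<in> {p. p permutes {0..<n}}" "i \<in> {0..<n}"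
    then have "i < n" "p i < n" by (auto simp: permutes_in_image)
    \<comment> \<open>The variable on the diagonal cancels; only the constant
      \<open>B i (p i) - A i (p i)\<close> remains.\<close>
    then show "char_poly_matrix (?M A) $$ (i, p i) - char_poly_matrix (?M B) $$ (i, p i)
        \<in> {p. \<forall>i. coeff p i \<in> I}"
      using uminus[OF assms[of i "p i"]]
      by (auto simp: char_poly_matrix_def coeff_pCons zero split: nat.split)
  qed (simp add: zero)
  then show ?thesis by (simp add: char_coeff_def)
qed

text \<open>Coefficients are compared in \<open>adj (x - A) * (x - A) = \<chi>(x)\<close>;
  multiplying the \<open>k\<close>-th identity by \<open>A ^ k\<close> on the right makes their sum
  telescope.\<close>

lemma cayley_hamilton_coeffs:
  fixes A :: "nat \<Rightarrow> nat \<Rightarrow> 'b::comm_ring_1"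
  assumes "i < n" "j < n"
  shows "(\<Sum>l\<le>n. char_coeff n A l * mat_pow class_ring n A l i j) = 0"
proof -
  define X where "X = char_poly_matrix (mat n n (\<lambda>(i, j). A i j))"
  define B where "B = adj_mat X"
  have X: "X \<in> carrier_mat n n" by (simp add: X_def)
  have B: "B \<in> carrier_mat n n" using adj_mat(1)[OF X] by (simp add: B_def)
  have eq: "B * X = char_poly (mat n n (\<lambda>(i, j). A i j)) \<cdot>\<^sub>m 1\<^sub>m n"
    using adj_mat(3)[OF X] by (simp add: B_def X_def char_poly_def)
  \<comment> \<open>\<open>b k\<close> holds the coefficients of \<open>x ^ k\<close> in
    \<open>x * adj (x - A)\<close>. The shift by one gives \<open>b 0 = 0\<close>, so the lower end
    of the telescoping sum vanishes.\<close>
  define b where "b k i j = (if k = 0 then 0 else coeff (B $$ (i, j)) (k - 1))" for k i j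
  text \<open>The coefficient of \<open>x ^ k\<close> in \<open>adj (x - A) * (x - A) = \<chi>(x)\<close>.\<close>
  have step: "(if i = t then char_coeff n A k else 0)
      = b k i t - (\<Sum>l<n. b (Suc k) i l * A l t)" if "i < n" "t < n" for i t k
  proof -
    have "(B * X) $$ (i, t) = (\<Sum>l<n. B $$ (i, l) * X $$ (l, t))"
      using that B X by (simp add: scalar_prod_def atLeast0LessThan)
    also have "\<dots> = (\<Sum>l<n. (if l = t then pCons 0 (B $$ (i, l)) else 0) - smult (A l t) (B $$ (i, l)))"
      using that by (intro sum.cong) (auto simp: X_def char_poly_matrix_def algebra_simps)
    also have "\<dots> = pCons 0 (B $$ (i, t)) - (\<Sum>l<n. smult (A l t) (B $$ (i, l)))"
      using that by (simp add: sum_subtractf)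
    finally have "coeff ((char_poly (mat n n (\<lambda>(i, j). A i j)) \<cdot>\<^sub>m 1\<^sub>m n) $$ (i, t)) k
        = coeff (pCons 0 (B $$ (i, t)) - (\<Sum>l<n. smult (A l t) (B $$ (i, l)))) k"
      by (simp add: eq)
    then show ?thesis
      using that by (auto simp: b_def char_coeff_def coeff_sum coeff_pCons mult.commute
          split: nat.splits)
  qed
  have tele: "(\<Sum>l<K. char_coeff n A l * mat_pow class_ring n A l i j)
      = - (\<Sum>t<n. b K i t * mat_pow class_ring n A K t j)" if "i < n" "j < n" for i j K
    using that
  proof (induction K)
    case 0
    then show ?case by (simp add: b_def)
  next
    case (Suc K)
    have "char_coeff n A K * mat_pow class_ring n A K i j
        = (\<Sum>t<n. (if i = t then char_coeff n A K else 0) * mat_pow class_ring n A K t j)"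
      using Suc.prems by (simp add: if_distrib[of "\<lambda>x. x * _"] cong: if_cong)
    also have "\<dots> = (\<Sum>t<n. b K i t * mat_pow class_ring n A K t j)
        - (\<Sum>t<n. (\<Sum>l<n. b (Suc K) i l * A l t) * mat_pow class_ring n A K t j)"
      using Suc.prems by (simp add: step algebra_simps sum_subtractf)
    also have "(\<Sum>t<n. (\<Sum>l<n. b (Suc K) i l * A l t) * mat_pow class_ring n A K t j)
        = (\<Sum>l<n. b (Suc K) i l * (\<Sum>t<n. A l t * mat_pow class_ring n A K t j))"
      by (simp add: sum_distrib_left sum_distrib_right mult.assoc) (rule sum.swap)
    also have "\<dots> = (\<Sum>l<n. b (Suc K) i l * mat_pow class_ring n A (Suc K) l j)"
      using Suc.prems by (intro sum.cong) (auto simp only: mat_pow_class_ring_Suc_left lessThan_iff)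
    finally show ?case using Suc.IH[OF Suc.prems] by simp
  qed
  \<comment> \<open>\<open>K\<close> exceeds the degrees in row \<open>i\<close> of the adjugate,
    which kills the upper end of the telescoping sum, and is at least \<open>n\<close>, so that all
    coefficients of \<chi> are included.\<close>
  define K where "K = Max (insert n ((\<lambda>t. degree (B $$ (i, t)) + 2) ` {..<n}))"
  have "n \<le> K" by (simp add: K_def)
  have "b (Suc K) i t = 0" if "t < n" for t
  proof -
    have "degree (B $$ (i, t)) + 2 \<le> K" unfolding K_def using that by (intro Max_ge) auto
    then show ?thesis by (simp add: b_def coeff_eq_0)
  qed
  then have "(\<Sum>l<Suc K. char_coeff n A l * mat_pow class_ring n A l i j) = 0"
    using tele[OF assms, of "Suc K"] by simp
  moreover have "(\<Sum>l<Suc K. char_coeff n A l * mat_pow class_ring n A l i j)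
      = (\<Sum>l\<le>n. char_coeff n A l * mat_pow class_ring n A l i j)"
  proof (rule sum.mono_neutral_right)
    show "\<forall>l\<in>{..<Suc K} - {..n}. char_coeff n A l * mat_pow class_ring n A l i j = 0"
      using degree_monic_char_poly[of "mat n n (\<lambda>(i, j). A i j)" n]
      by (auto simp: char_coeff_def coeff_eq_0)
  qed (use \<open>n \<le> K\<close> in auto)
  ultimately show ?thesis by simp
qed

text \<open>Since \<chi> is monic, the top power can be isolated; the reduction by companion
  matrices asks for this form.\<close>

lemma cayley_hamilton:
  fixes A :: "nat \<Rightarrow> nat \<Rightarrow> 'b::comm_ring_1"
  assumes "i < n" "j < n"
  shows "mat_pow class_ring n A n i j = - (\<Sum>l<n. char_coeff n A l * mat_pow class_ring n A l i j)"
proof -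
  have "char_coeff n A n = 1"
    using degree_monic_char_poly[of "mat n n (\<lambda>(i, j). A i j)" n] by (simp add: char_coeff_def)
  then show ?thesis
    using cayley_hamilton_coeffs[OF assms, of A]
    by (simp add: lessThan_Suc_atMost[symmetric] eq_neg_iff_add_eq_0 add.commute)
qed

subsection \<open>Powers of an ideal\<close>

text \<open>Products of \<open>k\<close> elements of \<open>M\<close> with one arbitrary cofactor,
  which is why level 0 is everything. For an ideal they generate its \<open>k\<close>-th power
  additively.\<close>

primrec products :: "'b::comm_monoid_mult set \<Rightarrow> nat \<Rightarrow> 'b set" where
  "products M 0 = UNIV"
| "products M (Suc k) = {p * u | p u. p \<in> products M k \<and> u \<in> M}"

lemma products_Suc_subset: "p \<in> products M (Suc k) \<Longrightarrow> p \<in> products M k"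
proof (induction k arbitrary: p)
  case (Suc k)
  then obtain q u where p: "p = q * u" "q \<in> products M (Suc k)" "u \<in> M"
    unfolding products.simps(2)[of M "Suc k"] by blast
  then have "q \<in> products M k" using Suc.IH by blast
  with p show ?case by auto
qed simp

lemma products_mono: "p \<in> products M m \<Longrightarrow> k \<le> m \<Longrightarrow> p \<in> products M k"
  by (rotate_tac, induction rule: inc_induct) (assumption, rule products_Suc_subset)

context class_ideal
begin

abbreviation ipow :: "nat \<Rightarrow> 'b set" where
  "ipow \<equiv> ideal_pow class_ring I"

lemma ideal_ipow: "ideal (ipow k) class_ring"
proof -
  interpret cring "class_ring :: 'b ring" by (rule cring_class_ring)
  show ?thesis by (induction k) (simp_all del: class_ring_simps add: oneideal ideal_prod_is_ideal ideal)
qed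

lemma class_ideal_ipow: "class_ideal (ipow k)"
  by (rule class_ideal.intro) (rule ideal_ipow)

lemmas ipow_zero = class_ideal.zero[OF class_ideal_ipow]
  and ipow_add = class_ideal.add[OF class_ideal_ipow]
  and ipow_mult_left = class_ideal.mult_left[OF class_ideal_ipow]
  and ipow_mult_right = class_ideal.mult_right[OF class_ideal_ipow]

lemma ipow_Suc_mult: "a \<in> ipow k \<Longrightarrow> u \<in> I \<Longrightarrow> a * u \<in> ipow (Suc k)"
  using ideal_prod.prod[of a "ipow k" u I class_ring] by simp

lemma ipow_Suc_subset: "a \<in> ipow (Suc k) \<Longrightarrow> a \<in> ipow k"
proof -
  assume "a \<in> ipow (Suc k)"
  then have "a \<in> ideal_prod class_ring (ipow k) I" by simp
  then show ?thesis by (induction rule: ideal_prod.induct) (auto intro: ipow_mult_right ipow_add)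
qed

lemma ipow_mono: "a \<in> ipow m \<Longrightarrow> k \<le> m \<Longrightarrow> a \<in> ipow k"
  by (rotate_tac, induction rule: inc_induct) (assumption, rule ipow_Suc_subset)

text \<open>Every element of \<open>ipow k\<close> is a finite sum of members of
  \<open>products I k\<close>. The predicate is kept general, as the inductive step applies the
  hypothesis to \<open>\<lambda>i. Q (i * j)\<close>.\<close>

lemma ipow_induct [consumes 1, case_names products add]:
  assumes "a \<in> ipow k" "\<And>a. a \<in> products I k \<Longrightarrow> Q a" "\<And>a b. Q a \<Longrightarrow> Q b \<Longrightarrow> Q (a + b)"
  shows "Q a"
  using assms
proof (induction k arbitrary: a Q)
  case 0
  then show ?case by simp
next
  case (Suc k)
  have gen: "Q (i * j)" if "i \<in> ipow k" "j \<in> I" for i j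
    using that(1)
  proof (rule Suc.IH)
    fix a assume "a \<in> products I k"
    then show "Q (a * j)" using Suc.prems(2) that(2) by auto
  next
    fix a b assume "Q (a * j)" "Q (b * j)"
    then show "Q ((a + b) * j)" using Suc.prems(3) by (simp add: distrib_right)
  qed
  from Suc.prems(1) have "a \<in> ideal_prod class_ring (ipow k) I" by simp
  then show ?case by (induction rule: ideal_prod.induct) (auto intro: gen Suc.prems(3))
qed

end

subsection \<open>Uniform continuity of integer-valued polynomials\<close>

locale dom_ideal = class_ideal I for I :: "'a::idom set"
begin

text \<open>If \<open>P / d\<close> is integer-valued of degree at most \<open>N + 1\<close> and vanishes at 0, then so is
  \<open>x \<mapsto> (P (x * u) - u ^ (N + 1) * P x) / d\<close>, but of degree at most \<open>N\<close>. Hence, up to values of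
  lower degree, multiplying the argument by \<open>u \<in> I\<close> multiplies the value by a multiple of \<open>u\<close>.\<close>

lemma int_valued_products:
  assumes "degree P \<le> N" "poly P 0 = 0" "\<And>x. d dvd poly P x" "w \<in> products I (N * k)"
  shows "\<exists>a\<in>ipow k. poly P w = d * a"
  using assms
proof (induction N arbitrary: P w)
  case 0
  then obtain c where "P = [:c:]" by (metis degree_0_id le_zero_eq degree_eq_zeroE)
  with 0 show ?case using ipow_zero by (intro bexI[of _ 0]) auto
next
  case (Suc N)
  \<comment> \<open>\<open>N * k\<close> factors are reserved for the remainder of lower degree, and
    \<open>t\<close> further ones are peeled off, each raising the power of \<open>I\<close> by one.
    At \<open>t = k\<close> this uses \<open>Suc N * k\<close> factors in all.\<close>
  have "\<exists>a\<in>ipow t. poly P w = d * a" if "t \<le> k" "w \<in> products I (N * k + t)" for t w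
    using that
  proof (induction t arbitrary: w)
    case 0
    then show ?case using Suc.prems(3)[of w] by (auto simp: dvd_def)
  next
    case (Suc t)
    from Suc.prems(2) obtain q u where w: "w = q * u" "q \<in> products I (N * k + t)" "u \<in> I"
      by auto
    obtain a where a: "a \<in> ipow t" "poly P q = d * a"
      using Suc.IH[OF _ w(2)] Suc.prems(1) by auto
    define R where "R = pcompose P [:0, u:] - smult (u ^ Suc N) P"
    have R: "poly R x = poly P (u * x) - u ^ Suc N * poly P x" for x
      by (simp add: R_def poly_pcompose mult.commute)
    have "coeff R m = 0" if "m > N" for m
    proof (cases "m = Suc N")
      case False
      then have "coeff P m = 0" using that \<open>degree P \<le> Suc N\<close> by (simp add: coeff_eq_0)
      then show ?thesis by (simp add: R_def coeff_pcompose_linear)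
    qed (simp add: R_def coeff_pcompose_linear)
    then have "degree R \<le> N" by (intro degree_le) simp
    moreover have "poly R 0 = 0" using \<open>poly P 0 = 0\<close> by (simp add: R)
    moreover have "d dvd poly R x" for x
      unfolding R using \<open>\<And>x. d dvd poly P x\<close> by (intro dvd_diff dvd_mult)
    moreover have "q \<in> products I (N * k)" using products_mono[OF w(2)] by simp
    ultimately obtain b where b: "b \<in> ipow k" "poly R q = d * b"
      using \<open>\<And>P w. degree P \<le> N \<Longrightarrow> poly P 0 = 0 \<Longrightarrow> (\<And>x. d dvd poly P x) \<Longrightarrow>
        w \<in> products I (N * k) \<Longrightarrow> \<exists>a\<in>ipow k. poly P w = d * a\<close> by blast
    \<comment> \<open>One factor \<open>u\<close> of \<open>u ^ Suc N\<close> lifts \<open>a\<close>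
      to \<open>ipow (Suc t)\<close>; the others serve as a coefficient.\<close>
    have "poly P w = d * (b + u ^ N * (a * u))"
      using a(2) b(2) R[of q] w(1) by (simp add: algebra_simps)
    moreover have "b + u ^ N * (a * u) \<in> ipow (Suc t)"
      by (rule ipow_add[OF ipow_mono[OF b(1) Suc.prems(1)]
            ipow_mult_left[OF ipow_Suc_mult[OF a(1) w(3)]]])
    ultimately show ?case by blast
  qed
  from this[of k w] Suc.prems(4) show ?case by (simp add: add.commute)
qed

text \<open>The increment \<open>P (y + x) - P y\<close> is again divisible by \<open>d\<close> and
  vanishes at \<open>x = 0\<close>, so the previous lemma handles increments in
  \<open>products I (N * k)\<close>. Sums of them are reached one summand at a time.\<close>

lemma int_valued_poly_cont:
  assumes "degree P \<le> N" "\<And>x. d dvd poly P x" "x - y \<in> ipow (N * k)"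
  shows "\<exists>a\<in>ipow k. poly P x - poly P y = d * a"
proof -
  \<comment> \<open>All base points \<open>y\<close> at once, because adding a summand moves the
    base point.\<close>
  have "\<forall>y. \<exists>a\<in>ipow k. poly P (y + h) - poly P y = d * a" if "h \<in> ipow (N * k)" for h
    using that
  proof (induction rule: ipow_induct)
    case (products w)
    show ?case
    proof
      fix y
      define R where "R = pcompose P [:y, 1:] - [:poly P y:]"
      have R: "poly R x = poly P (y + x) - poly P y" for x
        by (simp add: R_def poly_pcompose)
      have "degree R \<le> N"
        unfolding R_def using assms(1) degree_pcompose_le[of P "[:y, 1:]"]
        by (intro degree_diff_le) auto
      moreover have "d dvd poly R x" for x unfolding R by (intro dvd_diff assms(2))
      ultimately have "\<exists>a\<in>ipow k. poly R w = d * a"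
        using products by (intro int_valued_products) (auto simp: R)
      then show "\<exists>a\<in>ipow k. poly P (y + w) - poly P y = d * a" by (simp add: R)
    qed
  next
    case (add a b)
    show ?case
    proof
      fix y
      obtain e f where "e \<in> ipow k" "poly P (y + a) - poly P y = d * e"
        "f \<in> ipow k" "poly P (y + a + b) - poly P (y + a) = d * f"
        using add by blast
      then show "\<exists>c\<in>ipow k. poly P (y + (a + b)) - poly P y = d * c"
        by (intro bexI[of _ "e + f"] ipow_add) (auto simp: algebra_simps)
    qed
  qed
  from this[OF assms(3)] have "\<exists>a\<in>ipow k. poly P (y + (x - y)) - poly P y = d * a" by blast
  then show ?thesis by simp
qed

text \<open>One matrix entry is varied at a time.\<close>

lemma int_valued_mat_cont:
  fixes A B :: "nat \<Rightarrow> nat \<Rightarrow> 'a"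
  assumes dvd: "\<And>A i j. i < n \<Longrightarrow> j < n \<Longrightarrow> d dvd mat_poly_eval class_ring n cs A i j"
    and AB: "\<And>i j. i < n \<Longrightarrow> j < n \<Longrightarrow> A i j - B i j \<in> ipow (length cs * k)"
    and ij: "i < n" "j < n"
  shows "\<exists>a\<in>ipow k. mat_poly_eval class_ring n cs A i j - mat_poly_eval class_ring n cs B i j = d * a"
proof -
  have entry: "\<exists>a\<in>ipow k. mat_poly_eval class_ring n cs (A(p := (A p)(q := x))) i j
      - mat_poly_eval class_ring n cs (A(p := (A p)(q := y))) i j = d * a"
    if "x - y \<in> ipow (length cs * k)" for A :: "nat \<Rightarrow> nat \<Rightarrow> 'a" and p q x y
  proof -
    \<comment> \<open>Entry \<open>(p, q)\<close> becomes the variable. Each factor \<open>X\<close>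
      has entries of degree at most 1, so the \<open>m\<close>-th power has entries of degree at
      most \<open>m\<close>.\<close>
    define X where "X = (\<lambda>i j. if i = p \<and> j = q then [:0, 1:] else [:A i j:])"
    define E where "E z = A(p := (A p)(q := z))" for z
    have E: "poly (X i j) z = E z i j" for i j z by (auto simp: X_def E_def)
    have pow: "degree (mat_pow class_ring n X m i j) \<le> m \<and>
        (\<forall>z. poly (mat_pow class_ring n X m i j) z = mat_pow class_ring n (E z) m i j)" for m i j
    proof (induction m arbitrary: i j)
      case 0
      show ?case by (simp add: mat_one_def)
    next
      case (Suc m)
      have "degree (mat_pow class_ring n X m i k * X k j) \<le> Suc m" for k
      proof (rule order.trans[OF degree_mult_le])
        have "degree (X k j) \<le> 1" by (simp add: X_def)
        with Suc.IH[of i k] show "degree (mat_pow class_ring n X m i k) + degree (X k j) \<le> Suc m"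
          by linarith
      qed
      then show ?case unfolding mat_pow_class_ring_Suc
        using Suc.IH by (auto simp: poly_sum E intro!: degree_sum_le)
    qed
    define P where "P = (\<Sum>m<length cs. smult (cs ! m) (mat_pow class_ring n X m i j))"
    have P: "poly P z = mat_poly_eval class_ring n cs (E z) i j" for z
      using pow by (simp add: P_def mat_poly_eval_class_ring poly_sum)
    have "degree P \<le> length cs" unfolding P_def
    proof (rule degree_sum_le)
      fix m assume "m \<in> {..<length cs}"
      then show "degree (smult (cs ! m) (mat_pow class_ring n X m i j)) \<le> length cs"
        using pow[of m i j] by (intro order.trans[OF degree_smult_le]) auto
    qed simp
    then have "\<exists>a\<in>ipow k. poly P x - poly P y = d * a"
      using that dvd ij by (intro int_valued_poly_cont) (auto simp: P)
    then show ?thesis by (simp add: P E_def)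
  qed
  \<comment> \<open>\<open>C S\<close> interpolates between \<open>B\<close> (empty
    \<open>S\<close>) and \<open>A\<close> (all positions).\<close>
  define C where "C S = (\<lambda>i j. if (i, j) \<in> S then A i j else B i j)" for S
  have "\<exists>a\<in>ipow k. mat_poly_eval class_ring n cs (C S) i j
      - mat_poly_eval class_ring n cs B i j = d * a" if "finite S" "S \<subseteq> {..<n} \<times> {..<n}" for S
    using that
  proof (induction S rule: finite_induct)
    case empty
    show ?case using ipow_zero by (intro bexI[of _ 0]) (auto simp: C_def)
  next
    case (insert s S)
    obtain p q where s: "s = (p, q)" by fastforce
    have 1: "(C S)(p := (C S p)(q := A p q)) = C (insert s S)"
      and 2: "(C S)(p := (C S p)(q := B p q)) = C S"
      using insert.hyps by (auto simp: s fun_eq_iff C_def)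
    have "A p q - B p q \<in> ipow (length cs * k)" using AB insert.prems by (simp add: s)
    from entry[OF this, of "C S" p q] obtain a where a: "a \<in> ipow k"
      "mat_poly_eval class_ring n cs (C (insert s S)) i j - mat_poly_eval class_ring n cs (C S) i j = d * a"
      unfolding 1 2 by blast
    obtain b where b: "b \<in> ipow k"
      "mat_poly_eval class_ring n cs (C S) i j - mat_poly_eval class_ring n cs B i j = d * b"
      using insert by auto
    have "mat_poly_eval class_ring n cs (C (insert s S)) i j - mat_poly_eval class_ring n cs B i j
        = d * (a + b)"
      unfolding distrib_left a(2)[symmetric] b(2)[symmetric] by simp
    then show ?case using ipow_add[OF a(1) b(1)] by blast
  qed
  from this[of "{..<n} \<times> {..<n}"] obtain a where a: "a \<in> ipow k"
    "mat_poly_eval class_ring n cs (C ({..<n} \<times> {..<n})) i j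
      - mat_poly_eval class_ring n cs B i j = d * a"
    by blast
  \<comment> \<open>\<open>C\<close> and \<open>A\<close> agree only at indices below
    \<open>n\<close>; congruence modulo the zero ideal turns this into equality of the
    values.\<close>
  interpret Z: class_ideal "{0 :: 'a}"
    by (rule class_ideal.intro, rule ring.zeroideal[OF cring.axioms(1)[OF cring_class_ring], simplified])
  have "mat_poly_eval class_ring n cs (C ({..<n} \<times> {..<n})) i j
      - mat_poly_eval class_ring n cs A i j \<in> {0}"
    using ij by (intro Z.cong_mat_poly_eval) (auto simp: C_def)
  with a show ?thesis by auto
qed

end

subsection \<open>Companion matrices\<close>

text \<open>Multiplication by \<open>x\<close> modulo
  \<open>x ^ n + (\<Sum>l<n. c l * x ^ l)\<close> in the basis of monomials; column \<open>j\<close>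
  represents \<open>x ^ (j + 1)\<close>.\<close>

definition companion :: "nat \<Rightarrow> (nat \<Rightarrow> 'b::comm_ring_1) \<Rightarrow> nat \<Rightarrow> nat \<Rightarrow> 'b" where
  "companion n c = (\<lambda>i j. if Suc j = n then - c i else if i = Suc j then 1 else 0)"

text \<open>If \<open>\<chi> = x ^ n + (\<Sum>l<n. c l * x ^ l)\<close> annihilates \<open>A\<close>, then column \<open>0\<close> of the \<open>m\<close>-th power of
  the companion matrix holds the remainder of \<open>x ^ m\<close> modulo \<open>\<chi>\<close>.\<close>

lemma mat_pow_via_companion:
  fixes A :: "nat \<Rightarrow> nat \<Rightarrow> 'b::comm_ring_1"
  assumes ann: "\<And>i j. i < n \<Longrightarrow> j < n \<Longrightarrow>
      mat_pow class_ring n A n i j = - (\<Sum>l<n. c l * mat_pow class_ring n A l i j)"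
    and "i < n" "j < n"
  shows "mat_pow class_ring n A m i j
    = (\<Sum>l<n. mat_pow class_ring n (companion n c) m l 0 * mat_pow class_ring n A l i j)"
  using assms(2,3)
proof (induction m arbitrary: j)
  case 0
  then show ?case
    by (simp add: mat_one_def if_distrib[of "\<lambda>x. x * _"] cong: if_cong)
next
  case (Suc m)
  let ?v = "\<lambda>l. mat_pow class_ring n (companion n c) m l 0"
  \<comment> \<open>Column \<open>k\<close> encodes \<open>x ^ (k + 1)\<close>; for the last column
    this is the annihilation hypothesis.\<close>
  have shift: "(\<Sum>l<n. companion n c l k * mat_pow class_ring n A l i j)
      = mat_pow class_ring n A (Suc k) i j" if "k < n" for k
  proof (cases "Suc k = n")
    case True
    then show ?thesis using ann[OF Suc.prems]
      by (simp add: companion_def sum_negf del: mat_pow.simps)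
  next
    case False
    then have "Suc k < n" using that by simp
    then show ?thesis using False
      by (simp add: companion_def if_distrib[of "\<lambda>x. x * _"] del: mat_pow.simps cong: if_cong)
  qed
  have "mat_pow class_ring n A (Suc m) i j
      = (\<Sum>k<n. (\<Sum>l<n. ?v l * mat_pow class_ring n A l i k) * A k j)"
    unfolding mat_pow_class_ring_Suc[of n A m] using Suc by (intro sum.cong) auto
  also have "\<dots> = (\<Sum>l<n. ?v l * mat_pow class_ring n A (Suc l) i j)"
    unfolding mat_pow_class_ring_Suc sum_distrib_left sum_distrib_right mult.assoc by (rule sum.swap)
  also have "\<dots> = (\<Sum>k<n. ?v k * (\<Sum>l<n. companion n c l k * mat_pow class_ring n A l i j))"
    by (intro sum.cong) (auto simp only: shift lessThan_iff)
  also have "\<dots> = (\<Sum>l<n. (\<Sum>k<n. companion n c l k * ?v k) * mat_pow class_ring n A l i j)"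
    unfolding sum_distrib_left sum_distrib_right
    by (subst sum.swap) (simp only: mult_ac)
  also have "\<dots> = (\<Sum>l<n. mat_pow class_ring n (companion n c) (Suc m) l 0 * mat_pow class_ring n A l i j)"
    using Suc.prems by (intro sum.cong) (auto simp only: mat_pow_class_ring_Suc_left lessThan_iff)
  finally show ?case .
qed

text \<open>By linearity, column \<open>0\<close> of the polynomial at the companion matrix holds
  its remainder modulo \<chi>, and here that remainder is \<open>d\<close> times the polynomial with
  coefficients \<open>s\<close>.\<close>

lemma mat_poly_eval_via_companion:
  fixes A :: "nat \<Rightarrow> nat \<Rightarrow> 'b::comm_ring_1"
  assumes "\<And>i j. i < n \<Longrightarrow> j < n \<Longrightarrow>
      mat_pow class_ring n A n i j = - (\<Sum>l<n. c l * mat_pow class_ring n A l i j)"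
    and "i < n" "j < n"
    and s: "\<And>l. l < n \<Longrightarrow> mat_poly_eval class_ring n cs (companion n c) l 0 = d * s l"
  shows "mat_poly_eval class_ring n cs A i j
    = d * mat_poly_eval class_ring n (map s [0..<n]) A i j"
proof -
  have "mat_poly_eval class_ring n cs A i j = (\<Sum>m<length cs. cs ! m *
      (\<Sum>l<n. mat_pow class_ring n (companion n c) m l 0 * mat_pow class_ring n A l i j))"
    unfolding mat_poly_eval_class_ring
    by (intro sum.cong refl arg_cong[where f = "(*) _"] mat_pow_via_companion assms)
  also have "\<dots> = (\<Sum>l<n. mat_poly_eval class_ring n cs (companion n c) l 0 * mat_pow class_ring n A l i j)"
    unfolding mat_poly_eval_class_ring sum_distrib_left sum_distrib_right
    by (subst sum.swap) (simp only: mult.assoc)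
  also have "\<dots> = (\<Sum>l<n. d * (s l * mat_pow class_ring n A l i j))"
    by (intro sum.cong) (auto simp: s mult.assoc)
  finally show ?thesis by (simp add: mat_poly_eval_class_ring sum_distrib_left)
qed

subsection \<open>The completion\<close>

context class_ideal
begin

abbreviation completion :: "(nat \<Rightarrow> 'b set) ring" where
  "completion \<equiv> adic_completion class_ring I"

text \<open>Points of the inverse limit are handled through sequences of representatives, the
  \<open>k\<close>-th one mattering only modulo \<open>ipow k\<close>.\<close>

definition coherent :: "(nat \<Rightarrow> 'b) \<Rightarrow> bool" where
  "coherent a \<longleftrightarrow> (\<forall>k. a (Suc k) - a k \<in> ipow k)"

definition limit :: "(nat \<Rightarrow> 'b) \<Rightarrow> nat \<Rightarrow> 'b set" where
  "limit a = (\<lambda>k. ipow k +>\<^bsub>class_ring\<^esub> a k)"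

lemma mem_coset_iff: "x \<in> ipow k +>\<^bsub>class_ring\<^esub> a \<longleftrightarrow> x - a \<in> ipow k"
proof
  assume "x - a \<in> ipow k"
  then show "x \<in> ipow k +>\<^bsub>class_ring\<^esub> a"
    unfolding a_r_coset_def' by (intro UN_I[of "x - a"]) auto
qed (auto simp: a_r_coset_def')

lemma coset_cong:
  assumes "a - b \<in> ipow k"
  shows "ipow k +>\<^bsub>class_ring\<^esub> a = ipow k +>\<^bsub>class_ring\<^esub> b"
proof -
  have "x - a \<in> ipow k \<longleftrightarrow> x - b \<in> ipow k" for x
    using class_ideal.add[OF class_ideal_ipow, of "x - a" k "a - b"]
      class_ideal.diff[OF class_ideal_ipow, of "x - b" k "a - b"] assms by auto
  then show ?thesis by (auto simp: mem_coset_iff)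
qed

lemma limit_cong: "(\<And>k. a k - b k \<in> ipow k) \<Longrightarrow> limit a = limit b"
  unfolding limit_def by (rule ext) (rule coset_cong)

lemma coherent_diff:
  assumes "coherent a" "k \<le> m"
  shows "a m - a k \<in> ipow k"
  using assms(2,1)
proof (induction m rule: dec_induct)
  case base
  then show ?case by (simp add: ipow_zero)
next
  case (step m)
  have "a (Suc m) - a m \<in> ipow k"
    using step ipow_mono[of "a (Suc m) - a m" m k] by (auto simp: coherent_def)
  then show ?case using step ipow_add[of "a (Suc m) - a m" k "a m - a k"] by simp
qed

text \<open>A representative is chosen in each coset; the inclusion
  \<open>x (Suc k) \<subseteq> x k\<close>, applied to the representative \<open>a (Suc k)\<close>,
  gives coherence.\<close>

lemma carrier_completion: "x \<in> carrier completion \<longleftrightarrow> (\<exists>a. coherent a \<and> x = limit a)"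
proof
  assume "x \<in> carrier completion"
  then have x: "x k \<in> a_rcosets\<^bsub>class_ring\<^esub> (ipow k)" "x (Suc k) \<subseteq> x k" for k
    by (auto simp: adic_completion_def)
  from x(1) have "\<forall>k. \<exists>a. x k = ipow k +>\<^bsub>class_ring\<^esub> a"
    by (simp add: A_RCOSETS_def')
  then obtain a where a: "\<And>k. x k = ipow k +>\<^bsub>class_ring\<^esub> a k" by metis
  have "a (Suc k) \<in> x (Suc k)" for k using mem_coset_iff ipow_zero by (simp add: a del: ideal_pow.simps)
  then have "a (Suc k) - a k \<in> ipow k" for k using x(2)[of k] mem_coset_iff a by blast
  then show "\<exists>a. coherent a \<and> x = limit a" using a
    by (intro exI[of _ a]) (auto simp: coherent_def limit_def)
next
  assume "\<exists>a. coherent a \<and> x = limit a"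
  then obtain a where a: "coherent a" "x = limit a" by blast
  have "x (Suc k) \<subseteq> x k" for k
  proof
    fix y assume "y \<in> x (Suc k)"
    then have "y - a (Suc k) \<in> ipow k"
      unfolding a(2) limit_def mem_coset_iff by (rule ipow_Suc_subset)
    then show "y \<in> x k"
      using a ipow_add[of "y - a (Suc k)" k "a (Suc k) - a k"]
      by (simp add: limit_def mem_coset_iff coherent_def)
  qed
  then show "x \<in> carrier completion"
    by (auto simp: adic_completion_def A_RCOSETS_def' a(2) limit_def)
qed

lemma limit_add: "limit a \<oplus>\<^bsub>completion\<^esub> limit b = limit (\<lambda>k. a k + b k)"
proof -
  have "(ipow k +>\<^bsub>class_ring\<^esub> a k) <+>\<^bsub>class_ring\<^esub> (ipow k +>\<^bsub>class_ring\<^esub> b k)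
      = ipow k +>\<^bsub>class_ring\<^esub> (a k + b k)" for k
    using abelian_subgroup.a_rcos_sum[OF abelian_subgroupI3, of "ipow k" class_ring "a k" "b k"]
      ideal_ipow[of k] cring_class_ring
    by (simp add: ideal_def ring_def cring_def)
  then show ?thesis by (simp add: adic_completion_def limit_def)
qed

lemma limit_mult: "limit a \<otimes>\<^bsub>completion\<^esub> limit b = limit (\<lambda>k. a k * b k)"
  using ideal.rcoset_mult_add[OF ideal_ipow] by (simp add: adic_completion_def limit_def)

lemma coset_zero: "ipow k +>\<^bsub>class_ring\<^esub> 0 = ipow k"
  by (auto simp: mem_coset_iff)

lemma completion_zero: "\<zero>\<^bsub>completion\<^esub> = limit (\<lambda>_. 0)"
  by (simp add: adic_completion_def limit_def coset_zero)

lemma completion_one: "\<one>\<^bsub>completion\<^esub> = limit (\<lambda>_. 1)"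
  by (simp add: adic_completion_def limit_def)

lemma adic_emb_eq_limit: "adic_emb class_ring I a = limit (\<lambda>_. a)"
  by (simp add: adic_emb_def limit_def)

lemma coherent_const: "coherent (\<lambda>_. a)"
  by (simp add: coherent_def ipow_zero)

lemma coherent_add: "coherent a \<Longrightarrow> coherent b \<Longrightarrow> coherent (\<lambda>k. a k + b k)"
  unfolding coherent_def by (intro allI class_ideal.cong_add[OF class_ideal_ipow]) auto

lemma coherent_mult: "coherent a \<Longrightarrow> coherent b \<Longrightarrow> coherent (\<lambda>k. a k * b k)"
  unfolding coherent_def by (intro allI class_ideal.cong_mult[OF class_ideal_ipow]) auto

lemma coherent_sum: "(\<And>x. x \<in> S \<Longrightarrow> coherent (f x)) \<Longrightarrow> coherent (\<lambda>k. \<Sum>x\<in>S. f x k)"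
  unfolding coherent_def by (intro allI class_ideal.cong_sum[OF class_ideal_ipow]) auto

lemma coherent_mat_pow:
  assumes "\<And>i j. i < n \<Longrightarrow> j < n \<Longrightarrow> coherent (c i j)" "i < n" "j < n"
  shows "coherent (\<lambda>k. mat_pow class_ring n (\<lambda>i j. c i j k) m i j)"
  using assms unfolding coherent_def
  by (intro allI class_ideal.cong_mat_pow[OF class_ideal_ipow]) auto

text \<open>The structure over which \<open>finsum\<close> unfolds recursively.\<close>

lemma abelian_monoid_completion: "abelian_monoid completion"
proof (rule abelian_monoidI)
  show "\<zero>\<^bsub>completion\<^esub> \<in> carrier completion"
    unfolding carrier_completion completion_zero using coherent_const by blast
next
  fix x y assume "x \<in> carrier completion" "y \<in> carrier completion"
  then show "x \<oplus>\<^bsub>completion\<^esub> y \<in> carrier completion"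
    unfolding carrier_completion using limit_add coherent_add by metis
qed (auto simp: carrier_completion completion_zero limit_add add_ac)

lemma finsum_completion:
  assumes "finite S" "\<And>x. x \<in> S \<Longrightarrow> coherent (f x)" "\<And>x. x \<in> S \<Longrightarrow> g x = limit (f x)"
  shows "finsum completion g S = limit (\<lambda>k. \<Sum>x\<in>S. f x k)"
  using assms
proof (induction S rule: finite_induct)
  case empty
  then show ?case
    using abelian_monoid.finsum_empty[OF abelian_monoid_completion] by (simp add: completion_zero)
next
  case (insert x S)
  have "g y \<in> carrier completion" if "y \<in> insert x S" for y
    using insert.prems that unfolding carrier_completion by blast
  then have "finsum completion g (insert x S) = g x \<oplus>\<^bsub>completion\<^esub> finsum completion g S"
    using insert.hyps by (intro abelian_monoid.finsum_insert[OF abelian_monoid_completion]) auto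
  then show ?case using insert by (simp add: limit_add)
qed

lemma mat_pow_completion:
  assumes "\<And>i j. i < n \<Longrightarrow> j < n \<Longrightarrow> coherent (c i j) \<and> C i j = limit (c i j)" "i < n" "j < n"
  shows "mat_pow completion n C m i j = limit (\<lambda>k. mat_pow class_ring n (\<lambda>i j. c i j k) m i j)"
  using assms(2,3)
proof (induction m arbitrary: i j)
  case 0
  then show ?case by (simp add: mat_one_def completion_zero completion_one)
next
  case (Suc m)
  have "finsum completion (\<lambda>l. mat_pow completion n C m i l \<otimes>\<^bsub>completion\<^esub> C l j) {..<n}
      = limit (\<lambda>k. \<Sum>l<n. mat_pow class_ring n (\<lambda>i j. c i j k) m i l * c l j k)"
    using Suc assms(1)
    by (intro finsum_completion) (auto simp: limit_mult intro!: coherent_mult coherent_mat_pow)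
  then show ?case by (simp add: mat_mult_def)
qed

text \<open>Sums and products of limits are computed termwise, hence so is polynomial
  evaluation.\<close>

lemma mat_poly_eval_completion:
  assumes "\<And>i j. i < n \<Longrightarrow> j < n \<Longrightarrow> coherent (c i j) \<and> C i j = limit (c i j)" "i < n" "j < n"
    and "\<And>m. m < length cs \<Longrightarrow> coherent (e m) \<and> cs ! m = limit (e m)"
  shows "mat_poly_eval completion n cs C i j
    = limit (\<lambda>k. mat_poly_eval class_ring n (map (\<lambda>m. e m k) [0..<length cs]) (\<lambda>i j. c i j k) i j)"
proof -
  have "mat_poly_eval completion n cs C i j
    = limit (\<lambda>k. \<Sum>m<length cs. e m k * mat_pow class_ring n (\<lambda>i j. c i j k) m i j)"
    unfolding mat_poly_eval_def using assms mat_pow_completion[OF assms(1-3)]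
    by (intro finsum_completion) (auto simp: limit_mult intro!: coherent_mult coherent_mat_pow)
  then show ?thesis by (simp add: mat_poly_eval_class_ring)
qed

end

subsection \<open>Integer-valued polynomials on matrices\<close>

lemma Fract_add_1: "Fract (a + b) 1 = Fract a 1 + Fract b (1 :: 'a::idom)"
  by simp

lemma Fract_sum: "Fract (\<Sum>x\<in>S. f x) 1 = (\<Sum>x\<in>S. Fract (f x) (1 :: 'a::idom))"
  by (induction S rule: infinite_finite_induct) (simp_all add: Zero_fract_def Fract_add_1 del: add_fract)

lemma Fract_eq_iff: "Fract a 1 = Fract b (1 :: 'a::idom) \<longleftrightarrow> a = b"
  by (simp add: eq_fract)

lemma mat_pow_Fract:
  "mat_pow class_ring n (\<lambda>i j. Fract (A i j) (1 :: 'a::idom)) m i j = Fract (mat_pow class_ring n A m i j) 1"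
proof (induction m arbitrary: i j)
  case 0
  show ?case by (simp add: mat_one_def Zero_fract_def One_fract_def)
next
  case (Suc m)
  then show ?case unfolding mat_pow_class_ring_Suc by (simp add: Fract_sum)
qed

text \<open>Clearing the denominator in \<open>f = g / d\<close> moves integrality from the fraction
  field to divisibility in the ring.\<close>

lemma Int_mat_dvd:
  fixes g :: "'a::idom poly"
  assumes f: "smult (inverse (Fract d 1)) (map_poly (\<lambda>a. Fract a 1) g) \<in> Int_mat n"
    and "d \<noteq> 0" "i < n" "j < n"
  shows "d dvd mat_poly_eval class_ring n (coeffs g) A i j"
proof -
  let ?e = "Fract d 1"
  have e: "?e \<noteq> 0" using Fract_eq_iff[of d 0] \<open>d \<noteq> 0\<close> by (simp add: Zero_fract_def)
  have "coeffs (map_poly (\<lambda>a. Fract a 1) g) = map (\<lambda>a. Fract a 1) (coeffs g)"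
    by (rule coeffs_map_poly) (auto simp: Zero_fract_def eq_fract)
  then have cs: "coeffs (smult (inverse ?e) (map_poly (\<lambda>a. Fract a 1) g))
      = map (\<lambda>a. inverse ?e * Fract a 1) (coeffs g)"
    using nonzero_imp_inverse_nonzero[OF e] by (simp add: coeffs_smult o_def del: inverse_fract)
  have "mat_poly_eval class_ring n (map (\<lambda>a. inverse ?e * Fract a 1) (coeffs g)) (\<lambda>i j. Fract (A i j) 1) i j
      \<in> range (\<lambda>a. Fract a 1)"
    using f assms(3,4) unfolding Int_mat_def cs[symmetric] by blast
  then obtain b where b: "mat_poly_eval class_ring n (map (\<lambda>a. inverse ?e * Fract a 1) (coeffs g))
      (\<lambda>i j. Fract (A i j) 1) i j = Fract b 1" by blast
  have "inverse ?e * Fract (mat_poly_eval class_ring n (coeffs g) A i j) 1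
    = mat_poly_eval class_ring n (map (\<lambda>a. inverse ?e * Fract a 1) (coeffs g)) (\<lambda>i j. Fract (A i j) 1) i j"
    unfolding mat_poly_eval_class_ring Fract_sum mat_pow_Fract length_map sum_distrib_left
    by (intro sum.cong) (simp_all add: mult.assoc[symmetric] del: inverse_fract)
  also have "\<dots> = Fract b 1" by (rule b)
  finally have "?e * (inverse ?e * Fract (mat_poly_eval class_ring n (coeffs g) A i j) 1) = ?e * Fract b 1"
    by simp
  then have "Fract (mat_poly_eval class_ring n (coeffs g) A i j) 1 = ?e * Fract b 1"
    by (simp only: mult.assoc[symmetric] right_inverse[OF e] mult_1_left)
  then have "mat_poly_eval class_ring n (coeffs g) A i j = d * b"
    by (simp add: eq_fract)
  then show ?thesis by simp
qed

section \<open>Evaluation at a matrix over the completion\<close>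

context dom_ideal
begin

theorem eval_completion_matrix:
  fixes cs :: "'a list"
  assumes dvd: "\<And>A i j. i < n \<Longrightarrow> j < n \<Longrightarrow> d dvd mat_poly_eval class_ring n cs A i j"
    and "d \<noteq> 0"
    and C: "\<And>i j. i < n \<Longrightarrow> j < n \<Longrightarrow> C i j \<in> carrier completion"
  shows "\<exists>s. set s \<subseteq> carrier completion \<and> (\<forall>i<n. \<forall>j<n.
    mat_poly_eval completion n (map (adic_emb class_ring I) cs) C i j
      = adic_emb class_ring I d \<otimes>\<^bsub>completion\<^esub> mat_poly_eval completion n s C i j)"
proof -
  have "\<forall>i j. \<exists>a. i < n \<longrightarrow> j < n \<longrightarrow> coherent a \<and> C i j = limit a"
    using C unfolding carrier_completion by blast
  then obtain c where c: "\<And>i j. i < n \<Longrightarrow> j < n \<Longrightarrow> coherent (c i j) \<and> C i j = limit (c i j)"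
    by metis
  \<comment> \<open>By \<open>int_valued_mat_cont\<close>, to know \<open>f (B)\<close> modulo \<open>I ^ k\<close> it suffices to know \<open>B\<close> modulo
    \<open>I ^ (length cs * k)\<close>; the successor makes \<open>N * k \<ge> k\<close>.\<close>
  define N where "N = Suc (length cs)"
  define A where "A k = (\<lambda>i j. c i j (N * k))" for k
  define B where "B k = companion n (char_coeff n (A k))" for k
  \<comment> \<open>The companion matrix has entries in the ring, so \<open>d\<close> divides the
    coefficients of the remainder; \<sigma> collects the quotients.\<close>
  have "\<forall>k l. \<exists>b. l < n \<longrightarrow> mat_poly_eval class_ring n cs (B k) l 0 = d * b"
    using dvd by (metis dvdE gr_implies_not_zero neq0_conv)
  then obtain \<sigma> where \<sigma>: "\<And>k l. l < n \<Longrightarrow> mat_poly_eval class_ring n cs (B k) l 0 = d * \<sigma> k l"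
    by metis
  have coh: "coherent (\<lambda>k. \<sigma> k l)" if "l < n" for l
    unfolding coherent_def
  proof
    fix k
    \<comment> \<open>Closeness passes from the matrices to their characteristic coefficients, then
      to the companion matrices, and by uniform continuity to the quotients.\<close>
    have "A (Suc k) i j - A k i j \<in> ipow (length cs * k)" if "i < n" "j < n" for i j
      unfolding A_def using c[OF that]
      by (intro ipow_mono[OF coherent_diff, of _ "N * k"]) (auto simp: N_def)
    then have "char_coeff n (A (Suc k)) i - char_coeff n (A k) i \<in> ipow (length cs * k)" for i
      by (intro class_ideal.cong_char_coeff[OF class_ideal_ipow])
    then have "B (Suc k) i j - B k i j \<in> ipow (length cs * k)" for i j
      using class_ideal.uminus[OF class_ideal_ipow] ipow_zero
      by (fastforce simp: B_def companion_def)
    then obtain a where "a \<in> ipow k"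
      "mat_poly_eval class_ring n cs (B (Suc k)) l 0 - mat_poly_eval class_ring n cs (B k) l 0 = d * a"
      using int_valued_mat_cont[OF dvd, where A = "B (Suc k)" and B = "B k" and k = k and i = l and j = 0] \<open>l < n\<close> by auto
    \<comment> \<open>The factor \<open>d\<close> stands outside \<open>a \<in> ipow k\<close>, so
      cancelling it in the domain loses no power of \<open>I\<close>.\<close>
    then have "d * (\<sigma> (Suc k) l - \<sigma> k l) = d * a"
      using \<sigma>[OF \<open>l < n\<close>] by (simp only: right_diff_distrib)
    with \<open>d \<noteq> 0\<close> \<open>a \<in> ipow k\<close> show "\<sigma> (Suc k) l - \<sigma> k l \<in> ipow k" by simp
  qed
  define s where "s = map (\<lambda>l. limit (\<lambda>k. \<sigma> k l)) [0..<n]"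
  have "limit (\<lambda>k. \<sigma> k l) \<in> carrier completion" if "l < n" for l
    unfolding carrier_completion using coh[OF that] by blast
  then have "set s \<subseteq> carrier completion" by (auto simp: s_def)
  moreover have "mat_poly_eval completion n (map (adic_emb class_ring I) cs) C i j
      = adic_emb class_ring I d \<otimes>\<^bsub>completion\<^esub> mat_poly_eval completion n s C i j"
    if ij: "i < n" "j < n" for i j
  proof -
    let ?c = "\<lambda>k i j. c i j k"
    have "mat_poly_eval completion n (map (adic_emb class_ring I) cs) C i j
        = limit (\<lambda>k. mat_poly_eval class_ring n (map (\<lambda>m. cs ! m) [0..<length cs]) (?c k) i j)"
      using mat_poly_eval_completion[OF c ij, where cs = "map (adic_emb class_ring I) cs" and e = "\<lambda>m _. cs ! m"]
      by (simp add: coherent_const adic_emb_eq_limit)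
    also have "\<dots> = limit (\<lambda>k. mat_poly_eval class_ring n cs (?c k) i j)"
      by (simp add: map_nth)
    also have "\<dots> = limit (\<lambda>k. d * mat_poly_eval class_ring n (map (\<sigma> k) [0..<n]) (?c k) i j)"
    proof (rule limit_cong)
      \<comment> \<open>With \<open>g\<close> and \<open>s_k\<close> the polynomials given by
        \<open>cs\<close> and \<open>\<sigma> k\<close>, modulo \<open>ipow k\<close>:
        \<open>g(?c k)\<close> is congruent to \<open>g(A k) = d s_k(A k)\<close>, and this to
        \<open>d s_k(?c k)\<close>.\<close>
      fix k
      interpret J: class_ideal "ipow k" by (rule class_ideal_ipow)
      have cA: "c i j k - A k i j \<in> ipow k" if "i < n" "j < n" for i j
        using J.uminus[OF coherent_diff[of "c i j" k "N * k"]] c[OF that] by (simp add: A_def N_def)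
      then have "mat_poly_eval class_ring n cs (?c k) i j - mat_poly_eval class_ring n cs (A k) i j \<in> ipow k"
        using ij by (intro J.cong_mat_poly_eval) (auto simp: ipow_zero)
      moreover have "mat_poly_eval class_ring n cs (A k) i j
          = d * mat_poly_eval class_ring n (map (\<sigma> k) [0..<n]) (A k) i j"
        using ij by (intro mat_poly_eval_via_companion[OF cayley_hamilton])
          (auto simp: \<sigma>[unfolded B_def])
      moreover have "mat_poly_eval class_ring n (map (\<sigma> k) [0..<n]) (A k) i j
          - mat_poly_eval class_ring n (map (\<sigma> k) [0..<n]) (?c k) i j \<in> ipow k"
        using ij J.uminus[OF cA] by (intro J.cong_mat_poly_eval) (auto simp: ipow_zero)
      then have "d * mat_poly_eval class_ring n (map (\<sigma> k) [0..<n]) (A k) i j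
          - d * mat_poly_eval class_ring n (map (\<sigma> k) [0..<n]) (?c k) i j \<in> ipow k"
        unfolding right_diff_distrib[symmetric] by (rule J.mult_left)
      ultimately show "mat_poly_eval class_ring n cs (?c k) i j
          - d * mat_poly_eval class_ring n (map (\<sigma> k) [0..<n]) (?c k) i j \<in> ipow k"
        using J.cong_trans by metis
    qed
    also have "\<dots> = adic_emb class_ring I d \<otimes>\<^bsub>completion\<^esub> mat_poly_eval completion n s C i j"
    proof -
      have "mat_poly_eval completion n s C i j
        = limit (\<lambda>k. mat_poly_eval class_ring n (map (\<sigma> k) [0..<n]) (?c k) i j)"
        using mat_poly_eval_completion[OF c ij, where cs = s and e = "\<lambda>l k. \<sigma> k l"] coh by (simp add: s_def)
      then show ?thesis by (simp add: adic_emb_eq_limit limit_mult)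
    qed
    finally show ?thesis .
  qed
  ultimately show ?thesis by blast
qed

end

text \<open>For every presentation \<open>f = g / d\<close>, the equality \<open>f(C) = s(C)\<close>
  is expressed inside the completion as \<open>g(C) = d s(C)\<close>.\<close>

theorem mainTheorem5:
  fixes M :: "('a::idom) set" and n :: nat and C :: "nat \<Rightarrow> nat \<Rightarrow> (nat \<Rightarrow> 'a set)"
  assumes "maximalideal M (class_ring :: 'a ring)"
    and "finite (carrier ((class_ring :: 'a ring) Quot M))"
    and "(\<Inter>k\<in>{1..}. ideal_pow (class_ring :: 'a ring) M k) = {0}"
    and "analytically_irreducible (sub_ring (localization M)) (loc_max_ideal M)"
    and "n \<ge> 1"
    and "\<forall>i<n. \<forall>j<n. C i j \<in> carrier (adic_completion (class_ring :: 'a ring) M)"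
  shows "\<forall>f \<in> Int_mat n. \<forall>(g :: 'a poly) (d :: 'a).
           d \<noteq> 0 \<and> f = smult (inverse (Fract d 1)) (map_poly (\<lambda>a. Fract a 1) g) \<longrightarrow>
           (\<exists>s. set s \<subseteq> carrier (adic_completion (class_ring :: 'a ring) M) \<and>
              (\<forall>i<n. \<forall>j<n.
                 mat_poly_eval (adic_completion (class_ring :: 'a ring) M) n
                    (map (adic_emb (class_ring :: 'a ring) M) (coeffs g)) C i j
                 = adic_emb (class_ring :: 'a ring) M d
                     \<otimes>\<^bsub>adic_completion (class_ring :: 'a ring) M\<^esub>
                   mat_poly_eval (adic_completion (class_ring :: 'a ring) M) n s C i j))"
proof -
  interpret dom_ideal M
    by (intro dom_ideal.intro class_ideal.intro maximalideal.axioms(1) assms(1))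
  show ?thesis
    using assms(6) by (intro ballI allI impI eval_completion_matrix) (auto intro: Int_mat_dvd)
qed

end
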